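(* Given any $\xi\in\mathbb{H}$ and any integer $N>1$, there exist $\mathbf{p},\mathbf{q}\in\mathcal{H}$ with $1\le|\mathbf{q}|_2\le N$ such that $$|\xi-\mathbf{p}\mathbf{q}^{-1}|_2<\frac{2}{|\mathbf{q}|_2N}.$$ Moreover, there are infinitely many pairs $\mathbf{p},\mathbf{q}\in\mathcal{H}$ (with $\mathbf{q}\ne0$) such that $$|\xi-\mathbf{p}\mathbf{q}^{-1}|_2<\frac{2}{|\mathbf{q}|_2^2}.$$
   Context: $\mathbb{H}$ denotes the real quaternions $\xi=a+bi+cj+dk$ with Euclidean norm $|\xi|_2=(a^2+b^2+c^2+d^2)^{1/2}$. The Hurwitz integers $\mathcal{H}$ are the quaternions $a+bi+cj+dk$ with either all of $a,b,c,d\in\mathbb{Z}$ or all of $a,b,c,d\in\mathbb{Z}+\frac12$. Pairs $\mathbf{p},\mathbf{q}$ are not required to be coprime. *)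

theory Defs
  imports "HOL-Analysis.Analysis"
begin

text \<open>Real quaternions \<open>a + b i + c j + d k\<close>, set up in the same way as the complex numbers
  in \<open>HOL.Complex\<close>.\<close>

codatatype quat = Quat (Qre: real) (Qi: real) (Qj: real) (Qk: real)

lemma quat_eqI:
  "\<lbrakk>Qre x = Qre y; Qi x = Qi y; Qj x = Qj y; Qk x = Qk y\<rbrakk> \<Longrightarrow> x = y"
  by (rule quat.expand) simp

lemma quat_eq_iff:
  "x = y \<longleftrightarrow> Qre x = Qre y \<and> Qi x = Qi y \<and> Qj x = Qj y \<and> Qk x = Qk y"
  by (auto intro: quat_eqI)

instantiation quat :: ab_group_add
begin

primcorec zero_quat where
  "Qre 0 = 0" | "Qi 0 = 0" | "Qj 0 = 0" | "Qk 0 = 0"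

primcorec plus_quat where
  "Qre (x + y) = Qre x + Qre y"
| "Qi (x + y) = Qi x + Qi y"
| "Qj (x + y) = Qj x + Qj y"
| "Qk (x + y) = Qk x + Qk y"

primcorec uminus_quat where
  "Qre (- x) = - Qre x"
| "Qi (- x) = - Qi x"
| "Qj (- x) = - Qj x"
| "Qk (- x) = - Qk x"

primcorec minus_quat where
  "Qre (x - y) = Qre x - Qre y"
| "Qi (x - y) = Qi x - Qi y"
| "Qj (x - y) = Qj x - Qj y"
| "Qk (x - y) = Qk x - Qk y"

instance
  by standard (simp_all add: quat_eq_iff)

end

instantiation quat :: ring_1
begin

primcorec one_quat where
  "Qre 1 = 1" | "Qi 1 = 0" | "Qj 1 = 0" | "Qk 1 = 0"

primcorec times_quat where
  "Qre (x * y) = Qre x * Qre y - Qi x * Qi y - Qj x * Qj y - Qk x * Qk y"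
| "Qi (x * y) = Qre x * Qi y + Qi x * Qre y + Qj x * Qk y - Qk x * Qj y"
| "Qj (x * y) = Qre x * Qj y - Qi x * Qk y + Qj x * Qre y + Qk x * Qi y"
| "Qk (x * y) = Qre x * Qk y + Qi x * Qj y - Qj x * Qi y + Qk x * Qre y"

instance
  by standard (simp_all add: quat_eq_iff algebra_simps)

end

lemma quat_unit_products:
  defines "i \<equiv> Quat 0 1 0 0" and "j \<equiv> Quat 0 0 1 0" and "k \<equiv> Quat 0 0 0 1"
  shows "i * i = - 1" "j * j = - 1" "k * k = - 1" "i * j = k" "j * k = i" "k * i = j"
  by (simp_all add: i_def j_def k_def quat_eq_iff)

instantiation quat :: real_algebra_1
begin

primcorec scaleR_quat where
  "Qre (r *\<^sub>R x) = r * Qre x"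
| "Qi (r *\<^sub>R x) = r * Qi x"
| "Qj (r *\<^sub>R x) = r * Qj x"
| "Qk (r *\<^sub>R x) = r * Qk x"

instance
  by standard (simp_all add: quat_eq_iff algebra_simps)

end

instantiation quat :: real_div_algebra
begin

text \<open>\<open>inverse x\<close> is the conjugate of \<open>x\<close> divided by the square of the Euclidean norm.\<close>

primcorec inverse_quat where
  "Qre (inverse x) = Qre x / ((Qre x)\<^sup>2 + (Qi x)\<^sup>2 + (Qj x)\<^sup>2 + (Qk x)\<^sup>2)"
| "Qi (inverse x) = - Qi x / ((Qre x)\<^sup>2 + (Qi x)\<^sup>2 + (Qj x)\<^sup>2 + (Qk x)\<^sup>2)"
| "Qj (inverse x) = - Qj x / ((Qre x)\<^sup>2 + (Qi x)\<^sup>2 + (Qj x)\<^sup>2 + (Qk x)\<^sup>2)"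
| "Qk (inverse x) = - Qk x / ((Qre x)\<^sup>2 + (Qi x)\<^sup>2 + (Qj x)\<^sup>2 + (Qk x)\<^sup>2)"

definition divide_quat :: "quat \<Rightarrow> quat \<Rightarrow> quat" where
  "x div y = x * inverse y" for x y :: quat

instance
proof
  fix x y :: quat
  define s where "s = (Qre x)\<^sup>2 + (Qi x)\<^sup>2 + (Qj x)\<^sup>2 + (Qk x)\<^sup>2"
  have s0: "s \<noteq> 0" if "x \<noteq> 0"
  proof
    assume "s = 0"
    moreover have "(Qre x)\<^sup>2 \<ge> 0" "(Qi x)\<^sup>2 \<ge> 0" "(Qj x)\<^sup>2 \<ge> 0" "(Qk x)\<^sup>2 \<ge> 0"
      by simp_all
    ultimately have "(Qre x)\<^sup>2 = 0" "(Qi x)\<^sup>2 = 0" "(Qj x)\<^sup>2 = 0" "(Qk x)\<^sup>2 = 0"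
      unfolding s_def by linarith+
    with that show False by (simp add: quat_eq_iff)
  qed
  have inv: "inverse x = Quat (Qre x / s) (- Qi x / s) (- Qj x / s) (- Qk x / s)"
    by (simp add: quat_eq_iff s_def)
  show "inverse x * x = 1" if "x \<noteq> 0"
    using s0[OF that] unfolding inv quat_eq_iff
    by (simp add: divide_simps) (simp add: s_def power2_eq_square algebra_simps)
  show "x * inverse x = 1" if "x \<noteq> 0"
    using s0[OF that] unfolding inv quat_eq_iff
    by (simp add: divide_simps) (simp add: s_def power2_eq_square algebra_simps)
  show "x div y = x * inverse y"
    by (simp add: divide_quat_def)
  show "inverse (0::quat) = 0"
    by (simp add: quat_eq_iff)
qed

end

instantiation quat :: real_normed_div_algebra
begin

definition norm_quat :: "quat \<Rightarrow> real" where
  "norm x = sqrt ((Qre x)\<^sup>2 + (Qi x)\<^sup>2 + (Qj x)\<^sup>2 + (Qk x)\<^sup>2)"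

definition sgn_quat :: "quat \<Rightarrow> quat" where
  "sgn x = x /\<^sub>R norm x" for x :: quat

definition dist_quat :: "quat \<Rightarrow> quat \<Rightarrow> real" where
  "dist x y = norm (x - y)" for x y :: quat

definition uniformity_quat :: "(quat \<times> quat) filter" where
  "uniformity = (INF e\<in>{0<..}. principal {(x::quat, y). dist x y < e})"

definition open_quat :: "quat set \<Rightarrow> bool" where
  "open U \<longleftrightarrow> (\<forall>x\<in>U. \<forall>\<^sub>F (x', y) in uniformity. x' = x \<longrightarrow> y \<in> U)" for U :: "quat set"

instance
proof
  fix x y :: quat and r :: real and U :: "quat set"
  show "dist x y = norm (x - y)" by (rule dist_quat_def)
  show "sgn x = x /\<^sub>R norm x" by (rule sgn_quat_def)
  show "uniformity = (INF e\<in>{0<..}. principal {(x::quat, y). dist x y < e})"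
    by (rule uniformity_quat_def)
  show "open U \<longleftrightarrow> (\<forall>x\<in>U. \<forall>\<^sub>F (x', y) in uniformity. x' = x \<longrightarrow> y \<in> U)"
    by (rule open_quat_def)
  have norm4: "norm z = norm ((Qre z, Qi z), (Qj z, Qk z))" for z :: quat
    by (simp add: norm_quat_def norm_Pair add.assoc)
  show "norm x = 0 \<longleftrightarrow> x = 0"
    unfolding norm4 norm_eq_zero by (simp add: quat_eq_iff zero_prod_def)
  show "norm (x + y) \<le> norm x + norm y"
    using norm_triangle_ineq[of "((Qre x, Qi x), (Qj x, Qk x))" "((Qre y, Qi y), (Qj y, Qk y))"]
    unfolding norm4 by simp
  show "norm (r *\<^sub>R x) = \<bar>r\<bar> * norm x"
    unfolding norm_quat_def
    by (simp add: power_mult_distrib real_sqrt_mult flip: distrib_left)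
  show "norm (x * y) = norm x * norm y"
    unfolding norm_quat_def real_sqrt_mult[symmetric]
    by (rule arg_cong[where f = sqrt]) (simp add: power2_eq_square algebra_simps)
qed

end

definition hurwitz_integers :: "quat set" where
  "hurwitz_integers =
     {x. (Qre x \<in> \<int> \<and> Qi x \<in> \<int> \<and> Qj x \<in> \<int> \<and> Qk x \<in> \<int>) \<or>
         (Qre x - 1/2 \<in> \<int> \<and> Qi x - 1/2 \<in> \<int> \<and> Qj x - 1/2 \<in> \<int> \<and> Qk x - 1/2 \<in> \<int>)}"

end

theory Submission
  imports Defs
begin

text \<open>The pairs \<open>(q, \<xi> q - p)\<close> form a lattice of rank two over the Hurwitz integers. Under the
  Hermitian form \<open>t \<bar>q\<bar>\<^sup>2 + \<bar>\<xi> q - p\<bar>\<^sup>2 / t\<close> it has a pair of vectors with Gram determinant 1.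
  Since every quaternion lies within \<open>1/\<surd>2\<close> of a Hurwitz integer, Gauss--Lagrange reduction keeps
  the Gram determinant and yields a nonzero vector whose form value is arbitrarily close to
  \<open>\<surd>2\<close>, or smaller, hence less than \<open>3/2\<close>. The choice \<open>t = 3 / (2 N\<^sup>2)\<close> then
  gives \<open>\<bar>q\<bar> < N\<close> and \<open>\<bar>\<xi> q - p\<bar> < 3 / (2 N)\<close>.\<close>

section \<open>Conjugation and the Euclidean inner product\<close>

definition quat_cnj :: "quat \<Rightarrow> quat" where
  "quat_cnj x = Quat (Qre x) (- Qi x) (- Qj x) (- Qk x)"

definition quat_dot :: "quat \<Rightarrow> quat \<Rightarrow> real" where
  "quat_dot x y = Qre x * Qre y + Qi x * Qi y + Qj x * Qj y + Qk x * Qk y"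

lemma quat_cnj_sel [simp]:
  "Qre (quat_cnj x) = Qre x" "Qi (quat_cnj x) = - Qi x"
  "Qj (quat_cnj x) = - Qj x" "Qk (quat_cnj x) = - Qk x"
  by (simp_all add: quat_cnj_def)

lemma quat_norm_sq: "(norm (x::quat))\<^sup>2 = (Qre x)\<^sup>2 + (Qi x)\<^sup>2 + (Qj x)\<^sup>2 + (Qk x)\<^sup>2"
  by (simp add: norm_quat_def)

lemma quat_norm_diff_sq:
  "(norm (x - y))\<^sup>2 = (norm x)\<^sup>2 - 2 * quat_dot x y + (norm y)\<^sup>2"
  unfolding quat_norm_sq by (simp add: quat_dot_def power2_eq_square algebra_simps)

lemma quat_dot_mult_right: "quat_dot x (y * a) = quat_dot (quat_cnj y * x) a"
  by (simp add: quat_dot_def algebra_simps)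

lemma quat_cnj_mult_self: "quat_cnj x * (x * a) = (norm x)\<^sup>2 *\<^sub>R a"
  unfolding quat_norm_sq by (simp add: quat_eq_iff power2_eq_square algebra_simps)

lemma quat_norm_cnj [simp]: "norm (quat_cnj x) = norm x"
  by (simp add: norm_quat_def)

lemma quat_cnj_mult: "quat_cnj (x * y) = quat_cnj y * quat_cnj x"
  by (simp add: quat_eq_iff algebra_simps)

lemma quat_cnj_cnj [simp]: "quat_cnj (quat_cnj x) = x"
  by (simp add: quat_eq_iff)

lemma quat_cnj_add: "quat_cnj (x + y) = quat_cnj x + quat_cnj y"
  by (simp add: quat_eq_iff)

lemma quat_cnj_scaleR: "quat_cnj (r *\<^sub>R x) = r *\<^sub>R quat_cnj x"
  by (simp add: quat_eq_iff)

lemma quat_dot_add_left: "quat_dot (x + y) z = quat_dot x z + quat_dot y z"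
  by (simp add: quat_dot_def algebra_simps)

lemma quat_dot_scaleR_left: "quat_dot (r *\<^sub>R x) y = r * quat_dot x y"
  by (simp add: quat_dot_def algebra_simps)

lemma quat_dot_scaleR_right: "quat_dot x (r *\<^sub>R y) = r * quat_dot x y"
  by (simp add: quat_dot_def algebra_simps)

section \<open>A weighted Hermitian form on pairs of quaternions\<close>

text \<open>Conjugation sits on the first argument, so the form is linear in the second under right
  multiplication, the side on which \<open>shear\<close> multiplies. On the diagonal it is the real
  scalar \<open>hnorm\<close>.\<close>

definition herm :: "real \<Rightarrow> quat \<times> quat \<Rightarrow> quat \<times> quat \<Rightarrow> quat" where
  "herm t v w = t *\<^sub>R (quat_cnj (fst v) * fst w) + (1 / t) *\<^sub>R (quat_cnj (snd v) * snd w)"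

definition hnorm :: "real \<Rightarrow> quat \<times> quat \<Rightarrow> real" where
  "hnorm t v = t * (norm (fst v))\<^sup>2 + (norm (snd v))\<^sup>2 / t"

text \<open>The off-diagonal entries of the Gram matrix are conjugate to each other, so their
  product is a squared norm and the determinant is real despite noncommutativity.\<close>

definition gram :: "real \<Rightarrow> quat \<times> quat \<Rightarrow> quat \<times> quat \<Rightarrow> real" where
  "gram t v w = hnorm t v * hnorm t w - (norm (herm t v w))\<^sup>2"

definition shear :: "quat \<times> quat \<Rightarrow> quat \<times> quat \<Rightarrow> quat \<Rightarrow> quat \<times> quat" where
  "shear v w a = (fst w - fst v * a, snd w - snd v * a)"

lemma herm_shear: "herm t v (shear v w a) = herm t v w - hnorm t v *\<^sub>R a"
  by (simp add: herm_def shear_def hnorm_def right_diff_distrib quat_cnj_mult_self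
      scaleR_right_diff_distrib scaleR_left_distrib)

lemma hnorm_shear:
  "hnorm t (shear v w a) = hnorm t w - 2 * quat_dot (herm t v w) a + hnorm t v * (norm a)\<^sup>2"
  by (simp add: herm_def shear_def hnorm_def quat_norm_diff_sq quat_dot_mult_right
      quat_dot_add_left quat_dot_scaleR_left norm_mult power_mult_distrib
      add_divide_distrib diff_divide_distrib algebra_simps)

text \<open>With \<open>n = hnorm t v\<close> and \<open>h = herm t v w\<close>, both terms of the
  determinant change by \<open>- 2 * n * quat_dot h a + n^2 * (norm a)^2\<close>, which
  cancels.\<close>

lemma gram_shear: "gram t v (shear v w a) = gram t v w"
  unfolding gram_def herm_shear hnorm_shear quat_norm_diff_sq quat_dot_scaleR_right
  by (simp add: power_mult_distrib power2_eq_square algebra_simps)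

lemma gram_commute: "gram t v w = gram t w v"
proof -
  have "herm t w v = quat_cnj (herm t v w)"
    by (simp add: herm_def quat_cnj_add quat_cnj_scaleR quat_cnj_mult)
  then show ?thesis
    by (simp add: gram_def mult.commute)
qed

lemma hnorm_nonneg: "t > 0 \<Longrightarrow> hnorm t v \<ge> 0"
  by (simp add: hnorm_def)

section \<open>Rounding to Hurwitz integers\<close>

text \<open>Take the nearest integer and the midpoint of the unit interval containing
  \<open>x\<close>. The two distances add up to 1/2, so their squares add up to at most 1/4.\<close>

lemma half_int_rounding:
  fixes x :: real
  obtains a b where "a \<in> \<int>" "b - 1/2 \<in> \<int>" "(x - a)\<^sup>2 + (x - b)\<^sup>2 \<le> 1/4"
proof
  define u where "u = x - of_int \<lfloor>x\<rfloor>"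
  define e :: int where "e = (if u \<le> 1/2 then 0 else 1)"
  have u: "0 \<le> u" "u \<le> 1" unfolding u_def by linarith+
  show "of_int (\<lfloor>x\<rfloor> + e) \<in> (\<int> :: real set)" by (rule Ints_of_int)
  show "(of_int \<lfloor>x\<rfloor> + 1/2) - 1/2 \<in> (\<int> :: real set)" by simp
  have "(u - of_int e)\<^sup>2 + (u - 1/2)\<^sup>2 \<le> 1/4"
  proof (cases "u \<le> 1/2")
    case True
    then have "u * (1/2 - u) \<ge> 0" using u by simp
    then show ?thesis using True by (simp add: e_def power2_eq_square algebra_simps)
  next
    case False
    then have "(1 - u) * (u - 1/2) \<ge> 0" using u by simp
    then show ?thesis using False by (simp add: e_def power2_eq_square field_simps)
  qed
  then show "(x - of_int (\<lfloor>x\<rfloor> + e))\<^sup>2 + (x - (of_int \<lfloor>x\<rfloor> + 1/2))\<^sup>2 \<le> 1/4"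
    by (simp add: u_def algebra_simps)
qed

text \<open>The squared distances to the best integral and the best half-integral candidate add up to
  at most 1.\<close>
lemma hurwitz_rounding:
  obtains a where "a \<in> hurwitz_integers" "(norm (x - a))\<^sup>2 \<le> 1/2"
proof -
  obtain a1 b1 where 1: "a1 \<in> \<int>" "b1 - 1/2 \<in> \<int>" "(Qre x - a1)\<^sup>2 + (Qre x - b1)\<^sup>2 \<le> 1/4"
    by (rule half_int_rounding)
  obtain a2 b2 where 2: "a2 \<in> \<int>" "b2 - 1/2 \<in> \<int>" "(Qi x - a2)\<^sup>2 + (Qi x - b2)\<^sup>2 \<le> 1/4"
    by (rule half_int_rounding)
  obtain a3 b3 where 3: "a3 \<in> \<int>" "b3 - 1/2 \<in> \<int>" "(Qj x - a3)\<^sup>2 + (Qj x - b3)\<^sup>2 \<le> 1/4"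
    by (rule half_int_rounding)
  obtain a4 b4 where 4: "a4 \<in> \<int>" "b4 - 1/2 \<in> \<int>" "(Qk x - a4)\<^sup>2 + (Qk x - b4)\<^sup>2 \<le> 1/4"
    by (rule half_int_rounding)
  have H: "Quat a1 a2 a3 a4 \<in> hurwitz_integers" "Quat b1 b2 b3 b4 \<in> hurwitz_integers"
    using 1 2 3 4 by (simp_all add: hurwitz_integers_def)
  have "(norm (x - Quat a1 a2 a3 a4))\<^sup>2 + (norm (x - Quat b1 b2 b3 b4))\<^sup>2 \<le> 1"
    using 1 2 3 4 by (simp add: quat_norm_sq)
  then have "(norm (x - Quat a1 a2 a3 a4))\<^sup>2 \<le> 1/2 \<or> (norm (x - Quat b1 b2 b3 b4))\<^sup>2 \<le> 1/2"
    by linarith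
  with H that show thesis by blast
qed

section \<open>The ring of Hurwitz integers\<close>

lemma hurwitz_zero [simp]: "0 \<in> hurwitz_integers"
  and hurwitz_one [simp]: "1 \<in> hurwitz_integers"
  by (simp_all add: hurwitz_integers_def)

lemma lipschitz_in_hurwitz:
  "Quat (of_int a) (of_int b) (of_int c) (of_int d) \<in> hurwitz_integers"
  by (simp add: hurwitz_integers_def)

lemma hurwitz_uminus: "x \<in> hurwitz_integers \<Longrightarrow> - x \<in> hurwitz_integers"
proof -
  have *: "- r - 1/2 \<in> \<int>" if "r - 1/2 \<in> \<int>" for r :: real
  proof -
    have "- (r - 1/2) - 1 \<in> \<int>" by (intro Ints_diff Ints_minus that Ints_1)
    then show ?thesis by (simp add: algebra_simps)
  qed
  show "x \<in> hurwitz_integers \<Longrightarrow> - x \<in> hurwitz_integers"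
    using *[of "Qre x"] *[of "Qi x"] *[of "Qj x"] *[of "Qk x"]
    unfolding hurwitz_integers_def mem_Collect_eq uminus_quat.sel minus_in_Ints_iff by blast
qed

lemma hurwitz_add:
  assumes "x \<in> hurwitz_integers" "y \<in> hurwitz_integers"
  shows "x + y \<in> hurwitz_integers"
proof -
  have 1: "r + s - 1/2 \<in> \<int>" if "r - 1/2 \<in> \<int>" "s \<in> \<int>" for r s :: real
    using Ints_add[OF that] by (simp add: algebra_simps)
  have 2: "r + s - 1/2 \<in> \<int>" if "r \<in> \<int>" "s - 1/2 \<in> \<int>" for r s :: real
    using Ints_add[OF that] by (simp add: algebra_simps)
  have 3: "r + s \<in> \<int>" if "r - 1/2 \<in> \<int>" "s - 1/2 \<in> \<int>" for r s :: real
  proof -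
    have "(r - 1/2) + (s - 1/2) + 1 \<in> \<int>" using that by (intro Ints_add) simp_all
    then show ?thesis by simp
  qed
  show ?thesis
    using assms 1 2 3 by (auto simp: hurwitz_integers_def)
qed

lemma hurwitz_diff:
  "x \<in> hurwitz_integers \<Longrightarrow> y \<in> hurwitz_integers \<Longrightarrow> x - y \<in> hurwitz_integers"
  using hurwitz_add[of x "- y"] hurwitz_uminus[of y] by simp

definition hurwitz_half :: quat where
  "hurwitz_half = Quat (1/2) (1/2) (1/2) (1/2)"

lemma hurwitz_cases:
  assumes "x \<in> hurwitz_integers"
  obtains a b c d :: int where
    "x = Quat (of_int a) (of_int b) (of_int c) (of_int d) \<or>
     x = Quat (of_int a) (of_int b) (of_int c) (of_int d) + hurwitz_half"
proof -
  consider "Qre x \<in> \<int>" "Qi x \<in> \<int>" "Qj x \<in> \<int>" "Qk x \<in> \<int>"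
    | "Qre x - 1/2 \<in> \<int>" "Qi x - 1/2 \<in> \<int>" "Qj x - 1/2 \<in> \<int>" "Qk x - 1/2 \<in> \<int>"
    using assms by (auto simp: hurwitz_integers_def)
  then show thesis
  proof cases
    case 1
    then obtain a b c d where "Qre x = of_int a" "Qi x = of_int b" "Qj x = of_int c" "Qk x = of_int d"
      by (auto elim!: Ints_cases)
    then show thesis using that[of a b c d] by (simp add: quat_eq_iff)
  next
    case 2
    then obtain a b c d where "Qre x - 1/2 = of_int a" "Qi x - 1/2 = of_int b"
      "Qj x - 1/2 = of_int c" "Qk x - 1/2 = of_int d"
      by (metis Ints_cases)
    then show thesis using that[of a b c d] by (simp add: quat_eq_iff hurwitz_half_def algebra_simps)
  qed
qed

text \<open>Each coordinate of the product is half a signed sum of \<open>a, b, c, d\<close>. All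
  these sums have the parity of \<open>a + b + c + d\<close>, so the coordinates are all integers or
  all half-integers; \<open>e\<close> records which.\<close>

lemma half_mult_lipschitz:
  defines "h \<equiv> hurwitz_half"
  fixes a b c d :: int
  defines "z \<equiv> Quat (of_int a) (of_int b) (of_int c) (of_int d)"
  shows "h * z \<in> hurwitz_integers" and "z * h \<in> hurwitz_integers"
proof -
  obtain m where m: "a + b + c + d = 2 * m \<or> a + b + c + d = 2 * m + 1"
    by (metis evenE oddE)
  define e :: quat where "e = (if even (a + b + c + d) then 0 else h)"
  have h: "h \<in> hurwitz_integers" by (simp add: h_def hurwitz_half_def hurwitz_integers_def)
  then have e: "e \<in> hurwitz_integers" by (simp add: e_def)
  from m consider "a = 2 * m - b - c - d" "e = 0" | "a = 2 * m + 1 - b - c - d" "e = h"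
    unfolding e_def by (cases "even (a + b + c + d)") auto
  then have eq: "h * z = Quat (of_int (m - b - c - d)) (of_int (m - c)) (of_int (m - d)) (of_int (m - b)) + e
      \<and> z * h = Quat (of_int (m - b - c - d)) (of_int (m - d)) (of_int (m - b)) (of_int (m - c)) + e"
    by cases (simp_all add: z_def h_def hurwitz_half_def quat_eq_iff field_simps)
  show "h * z \<in> hurwitz_integers" "z * h \<in> hurwitz_integers"
    unfolding eq[THEN conjunct1] eq[THEN conjunct2]
    by (intro hurwitz_add lipschitz_in_hurwitz e)+
qed

text \<open>Each factor is an integral quaternion plus possibly \<open>hurwitz_half\<close>;
  distributivity leaves integral products, the mixed products treated above, and the square of
  \<open>hurwitz_half\<close>.\<close>

lemma hurwitz_mult:
  assumes "x \<in> hurwitz_integers" "y \<in> hurwitz_integers"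
  shows "x * y \<in> hurwitz_integers"
proof -
  obtain a b c d where x: "x = Quat (of_int a) (of_int b) (of_int c) (of_int d) \<or>
     x = Quat (of_int a) (of_int b) (of_int c) (of_int d) + hurwitz_half" (is "x = ?z \<or> _")
    using hurwitz_cases[OF assms(1)] by metis
  obtain a' b' c' d' where y: "y = Quat (of_int a') (of_int b') (of_int c') (of_int d') \<or>
     y = Quat (of_int a') (of_int b') (of_int c') (of_int d') + hurwitz_half" (is "y = ?w \<or> _")
    using hurwitz_cases[OF assms(2)] by metis
  have zw: "?z * ?w \<in> hurwitz_integers"
    by (simp add: hurwitz_integers_def)
  have hh: "hurwitz_half * hurwitz_half \<in> hurwitz_integers"
    by (simp add: hurwitz_half_def hurwitz_integers_def)
  show ?thesis
    using x y zw hh half_mult_lipschitz[of a b c d] half_mult_lipschitz[of a' b' c' d']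
    by (auto simp: distrib_left distrib_right intro!: hurwitz_add)
qed

text \<open>In the integral case some nonzero coordinate contributes at least 1 to the squared norm;
  in the half-integral case all four contribute at least 1/4.\<close>

lemma hurwitz_norm_ge_1:
  assumes "x \<in> hurwitz_integers" "x \<noteq> 0"
  shows "norm x \<ge> 1"
proof -
  have int: "r\<^sup>2 \<ge> 1" if "r \<in> \<int>" "r \<noteq> 0" for r :: real
    using Ints_nonzero_abs_ge1[OF that] power_mono[of 1 "\<bar>r\<bar>" 2] by simp
  have half: "r\<^sup>2 \<ge> 1/4" if "r - 1/2 \<in> \<int>" for r :: real
  proof -
    have "2 * (r - 1/2) + 1 \<in> \<int>" using that by (intro Ints_add Ints_mult) simp_all
    then have "2 * r \<in> \<int>" by simp
    moreover have "r \<noteq> 0"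
    proof
      assume "r = 0"
      then have "1/2 \<in> (\<int> :: real set)" using that minus_in_Ints_iff[of "1/2::real"] by simp
      then show False using Ints_nonzero_abs_ge1[of "1/2::real"] by simp
    qed
    ultimately have "(2 * r)\<^sup>2 \<ge> 1" using int[of "2 * r"] by simp
    then show ?thesis by simp
  qed
  have "(norm x)\<^sup>2 \<ge> 1"
  proof (cases "Qre x \<in> \<int> \<and> Qi x \<in> \<int> \<and> Qj x \<in> \<int> \<and> Qk x \<in> \<int>")
    case True
    then show ?thesis
      using int[of "Qre x"] int[of "Qi x"] int[of "Qj x"] int[of "Qk x"] assms(2)
      unfolding quat_norm_sq quat_eq_iff
      by (smt (verit) zero_le_power2 zero_quat.sel)
  next
    case False
    then show ?thesis
      using half[of "Qre x"] half[of "Qi x"] half[of "Qj x"] half[of "Qk x"] assms(1)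
      unfolding quat_norm_sq hurwitz_integers_def by auto
  qed
  then show ?thesis
    using power2_le_imp_le[of 1 "norm x"] by simp
qed

section \<open>Reduction to a short vector\<close>

lemma gram_reduction:
  assumes t: "t > 0" and g: "gram t v w = 1"
  obtains a where "a \<in> hurwitz_integers"
    "hnorm t v * hnorm t (shear v w a) \<le> 1 + (hnorm t v)\<^sup>2 / 2"
proof -
  \<comment> \<open>A vanishing form value would make the Gram determinant nonpositive.\<close>
  have n: "hnorm t v > 0"
  proof (rule ccontr)
    assume "\<not> hnorm t v > 0"
    then have "hnorm t v = 0" using hnorm_nonneg[OF t, of v] by simp
    with g zero_le_power2[of "norm (herm t v w)"] show False unfolding gram_def by simp
  qed
  \<comment> \<open>The quotient rounded here is the real minimiser of
    \<open>hnorm t (shear v w a)\<close> in \<open>a\<close>.\<close>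
  obtain a where a: "a \<in> hurwitz_integers" "(norm ((1 / hnorm t v) *\<^sub>R herm t v w - a))\<^sup>2 \<le> 1/2"
    by (rule hurwitz_rounding)
  have "herm t v (shear v w a) = hnorm t v *\<^sub>R ((1 / hnorm t v) *\<^sub>R herm t v w - a)"
    using n by (simp add: herm_shear scaleR_right_diff_distrib)
  then have "(norm (herm t v (shear v w a)))\<^sup>2 \<le> (hnorm t v)\<^sup>2 * (1/2)"
    using a(2) by (simp only: norm_scaleR power_mult_distrib power2_abs) (intro mult_left_mono, auto)
  moreover have "gram t v (shear v w a) = 1" by (simp add: gram_shear g)
  ultimately show thesis using that[OF a(1)] by (simp add: gram_def)
qed

text \<open>With \<open>x = hnorm t v \<ge> 3/2\<close> a reduction step gives a vector of form value at most
  \<open>1/x + x/2 \<le> (17/18) x\<close>.\<close>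
lemma short_vector:
  assumes t: "t > 0"
    and closed: "\<And>v w a. v \<in> L \<Longrightarrow> w \<in> L \<Longrightarrow> a \<in> hurwitz_integers \<Longrightarrow> shear v w a \<in> L"
    and init: "v0 \<in> L" "w0 \<in> L" "gram t v0 w0 = 1"
  obtains v w where "v \<in> L" "gram t v w = 1" "hnorm t v < 3/2"
proof -
  define X where "X = {hnorm t v | v. v \<in> L \<and> (\<exists>w\<in>L. gram t v w = 1)}"
  define m where "m = Inf X"
  have ne: "X \<noteq> {}" unfolding X_def using init by blast
  have "bdd_below X" unfolding X_def using hnorm_nonneg[OF t] by (auto intro: bdd_belowI[of _ 0])
  then have low: "m \<le> x" if "x \<in> X" for x unfolding m_def using that by (rule cInf_lower[rotated])
  have "m < 3/2"
  proof (rule ccontr)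
    assume "\<not> m < 3/2"
    then have m: "m \<ge> 3/2" by simp
    \<comment> \<open>The infimum need not be attained, so a value within the factor 18/17 of it is
      reduced; this undoes the gain 17/18 = 4/9 + 1/2 available for \<open>x >= 3/2\<close>.\<close>
    then have "Inf X < 18/17 * m" unfolding m_def by simp
    then obtain x where x: "x \<in> X" "x < 18/17 * m" using cInf_lessD[OF ne] by blast
    then obtain v w where vw: "v \<in> L" "w \<in> L" "gram t v w = 1" "x = hnorm t v"
      unfolding X_def by blast
    obtain a where a: "a \<in> hurwitz_integers" "x * hnorm t (shear v w a) \<le> 1 + x\<^sup>2 / 2"
      using gram_reduction[OF t vw(3)] vw(4) by metis
    \<comment> \<open>The roles are swapped: the new vector comes first and the old \<open>v\<close>
      becomes its partner.\<close>
    have "gram t (shear v w a) v = 1" using gram_commute gram_shear vw(3) by metis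
    then have "hnorm t (shear v w a) \<in> X" unfolding X_def using closed vw a(1) by blast
    then have "m \<le> hnorm t (shear v w a)" by (rule low)
    moreover have x32: "x \<ge> 3/2" using low[OF x(1)] m by simp
    ultimately have "x * m \<le> x * hnorm t (shear v w a)" by (intro mult_left_mono) auto
    then have "x * m \<le> 1 + x\<^sup>2 / 2" using a(2) by simp
    moreover have "x * (17/18 * x) < x * m" using x(2) x32 by (intro mult_strict_left_mono) auto
    moreover have "(3/2) * (3/2) \<le> x * x" using x32 by (intro mult_mono) auto
    ultimately show False by (simp add: power2_eq_square)
  qed
  then obtain x where "x \<in> X" "x < 3/2" unfolding m_def using cInf_lessD[OF ne] by blast
  then show thesis unfolding X_def using that by auto
qed

section \<open>Dirichlet approximation\<close>

text \<open>A real \<open>N\<close> is allowed because the infinitude argument later takes a bound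
  of the form \<open>max 2 (2 / d)\<close>.\<close>

lemma dirichlet_hurwitz:
  fixes \<xi> :: quat and N :: real
  assumes N: "N \<ge> 2"
  obtains p q where "p \<in> hurwitz_integers" "q \<in> hurwitz_integers" "q \<noteq> 0" "norm q \<le> N"
    "norm (\<xi> * q - p) < 2 / N"
proof -
  define t where "t = 3 / (2 * N\<^sup>2)"
  have t: "t > 0" using N by (simp add: t_def)
  define L where "L = {(q, \<xi> * q - p) | p q. p \<in> hurwitz_integers \<and> q \<in> hurwitz_integers}"
  have closed: "shear v w a \<in> L" if vw: "v \<in> L" "w \<in> L" and a: "a \<in> hurwitz_integers" for v w a
  proof -
    obtain p q p' q' where pq: "p \<in> hurwitz_integers" "q \<in> hurwitz_integers"
      "p' \<in> hurwitz_integers" "q' \<in> hurwitz_integers" "v = (q, \<xi> * q - p)" "w = (q', \<xi> * q' - p')"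
      using vw unfolding L_def by blast
    \<comment> \<open>Since \<open>\<xi>\<close> acts from the left and \<open>a\<close> from the
      right, \<open>L\<close> is a right module over the Hurwitz integers.\<close>
    have "shear v w a = (q' - q * a, \<xi> * (q' - q * a) - (p' - p * a))"
      by (simp add: pq shear_def algebra_simps)
    then show ?thesis
      unfolding L_def using pq a hurwitz_diff hurwitz_mult by blast
  qed
  \<comment> \<open>The starting pair comes from \<open>p = 1, q = 0\<close> and
    \<open>p = 0, q = 1\<close>. Its form values are \<open>1 / t\<close> and
    \<open>t + (norm \<xi>)^2 / t\<close>, and \<open>herm\<close> gives \<open>- \<xi> / t\<close>,
    so the Gram determinant is 1.\<close>
  have v0: "(0, - 1) \<in> L" unfolding L_def by (auto intro!: exI[of _ 1] exI[of _ 0])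
  have w0: "(1, \<xi>) \<in> L" unfolding L_def by (auto intro!: exI[of _ 1] exI[of _ 0])
  have "quat_cnj 0 = 0" "quat_cnj (- 1) = - 1" by (simp_all add: quat_eq_iff)
  then have "gram t (0, - 1) (1, \<xi>) = 1"
    using t by (simp add: gram_def hnorm_def herm_def power_divide power2_eq_square field_simps)
  from short_vector[OF t closed v0 w0 this] obtain v w
    where v: "v \<in> L" "gram t v w = 1" "hnorm t v < 3/2" by blast
  then obtain p q where pq: "p \<in> hurwitz_integers" "q \<in> hurwitz_integers" "v = (q, \<xi> * q - p)"
    unfolding L_def by blast
  have le: "t * (norm q)\<^sup>2 + (norm (\<xi> * q - p))\<^sup>2 / t < 3/2"
    using v(3) by (simp add: pq hnorm_def)
  have "t * (norm q)\<^sup>2 < 3/2" using le t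
    by (smt (verit) divide_nonneg_pos zero_le_power2)
  then have "(norm q)\<^sup>2 < N\<^sup>2" using N by (simp add: t_def field_simps)
  then have 1: "norm q \<le> N" using N power2_less_imp_less[of "norm q" N] by simp
  have "(norm (\<xi> * q - p))\<^sup>2 / t < 3/2" using le t
    by (smt (verit) mult_nonneg_nonneg zero_le_power2)
  then have "(norm (\<xi> * q - p))\<^sup>2 < 3/2 * t" using t by (simp add: field_simps)
  also have "\<dots> = (3 / (2 * N))\<^sup>2" by (simp add: t_def power2_eq_square)
  finally have 2: "norm (\<xi> * q - p) < 3 / (2 * N)" using N
    by (intro power2_less_imp_less[of "norm (\<xi> * q - p)"]) auto
  \<comment> \<open>For \<open>q = 0\<close> the bound forces \<open>norm p < 1\<close>, hence
    \<open>p = 0\<close> and \<open>v = 0\<close>, which contradicts Gram determinant 1.\<close>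
  have 3: "q \<noteq> 0"
  proof
    assume q: "q = 0"
    have "3 / (2 * N) < 1" using N by simp
    then have "norm p < 1" using 2 q by simp
    then have "p = 0" using hurwitz_norm_ge_1[OF pq(1)] by fastforce
    then have "gram t v w = - (norm (herm t v w))\<^sup>2" using q by (simp add: pq gram_def hnorm_def)
    then show False using v(2) zero_le_power2[of "norm (herm t v w)"] by linarith
  qed
  have "3 / (2 * N) < 2 / N" using N by (simp add: field_simps)
  with 1 2 3 pq that show thesis by force
qed

lemma norm_diff_quotient:
  fixes \<xi> p q :: quat
  assumes "q \<noteq> 0"
  shows "norm (\<xi> - p * inverse q) = norm (\<xi> * q - p) / norm q"
proof -
  have "(\<xi> - p * inverse q) * q = \<xi> * q - p" using assms by (simp add: algebra_simps)
  then show ?thesis using assms by (metis norm_mult norm_eq_zero nonzero_mult_div_cancel_right)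
qed

lemma dirichlet_hurwitz_quotient:
  fixes \<xi> :: quat and N :: real
  assumes "N \<ge> 2"
  obtains p q where "p \<in> hurwitz_integers" "q \<in> hurwitz_integers" "1 \<le> norm q" "norm q \<le> N"
    "norm (\<xi> - p * inverse q) < 2 / (norm q * N)"
proof -
  obtain p q where pq: "p \<in> hurwitz_integers" "q \<in> hurwitz_integers" "q \<noteq> 0" "norm q \<le> N"
    "norm (\<xi> * q - p) < 2 / N"
    using dirichlet_hurwitz[OF assms] by metis
  have "norm (\<xi> - p * inverse q) < 2 / N / norm q"
    unfolding norm_diff_quotient[OF pq(3)] using pq by (intro divide_strict_right_mono) auto
  with pq that[of p q] hurwitz_norm_ge_1[of q] show thesis by (simp add: mult.commute)
qed

section \<open>Infinitely many good pairs\<close>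

text \<open>If \<open>\<xi>\<close> is a quotient of Hurwitz integers, scaling numerator and
  denominator by positive integers gives infinitely many exact pairs. Otherwise all errors are
  positive, and finitely many of them would stay away from 0, against Dirichlet
  approximation.\<close>

lemma infinite_good_pairs:
  fixes \<xi> :: quat
  shows "infinite {(p, q). p \<in> hurwitz_integers \<and> q \<in> hurwitz_integers \<and> q \<noteq> 0 \<and>
                     norm (\<xi> - p * inverse q) < 2 / (norm q)\<^sup>2}" (is "infinite ?S")
proof (cases "\<exists>p\<in>hurwitz_integers. \<exists>q\<in>hurwitz_integers. q \<noteq> 0 \<and> \<xi> = p * inverse q")
  case True
  then obtain p q where pq: "p \<in> hurwitz_integers" "q \<in> hurwitz_integers" "q \<noteq> 0" "\<xi> = p * inverse q"
    by blast
  define f :: "nat \<Rightarrow> quat \<times> quat" where "f n = (p * of_nat (Suc n), q * of_nat (Suc n))" for n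
  have nat: "of_nat n \<in> hurwitz_integers" for n
    by (induction n) (auto intro: hurwitz_add)
  have "inj f"
    using pq(3) by (auto simp: inj_def f_def simp del: of_nat_Suc)
  moreover have "range f \<subseteq> ?S"
  proof clarify
    fix a b n assume "(a, b) = f n"
    then have ab: "a = p * of_nat (Suc n)" "b = q * of_nat (Suc n)" by (simp_all add: f_def)
    have n: "of_nat (Suc n) \<noteq> (0::quat)" by (rule of_nat_neq_0)
    have b: "b \<noteq> 0" using ab pq(3) n by simp
    have "\<xi> * b - a = 0" using ab pq(3,4) by (simp add: mult.assoc del: of_nat_Suc) (simp add: mult.assoc[symmetric])
    then have "norm (\<xi> - a * inverse b) = 0" using norm_diff_quotient[OF b] by simp
    then show "a \<in> hurwitz_integers \<and> b \<in> hurwitz_integers \<and> b \<noteq> 0 \<and>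
        norm (\<xi> - a * inverse b) < 2 / (norm b)\<^sup>2"
      using b nat pq(1,2,3) hurwitz_mult unfolding ab by (simp del: of_nat_Suc)
  qed
  ultimately show ?thesis
    using finite_subset range_inj_infinite by blast
next
  case False
  show ?thesis
  proof
    assume fin: "finite ?S"
    define E where "E = (\<lambda>(p, q). norm (\<xi> - p * inverse q)) ` ?S"
    have "finite E" unfolding E_def using fin by (rule finite_imageI)
    moreover have "e > 0" if e: "e \<in> E" for e
    proof -
      obtain p q where "p \<in> hurwitz_integers" "q \<in> hurwitz_integers" "q \<noteq> 0"
        "e = norm (\<xi> - p * inverse q)"
        using e unfolding E_def by auto
      with False show ?thesis by (metis right_minus_eq zero_less_norm_iff)
    qed
    ultimately have "\<exists>d>0. \<forall>e\<in>E. d \<le> e"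
      \<comment> \<open>Inserting 1 keeps the minimum meaningful even if \<open>E\<close> is
        empty.\<close>
      by (intro exI[of _ "Min (insert 1 E)"]) auto
    then obtain d where d: "d > 0" "\<And>e. e \<in> E \<Longrightarrow> d \<le> e" by blast
    \<comment> \<open>As \<open>norm q >= 1\<close>, the error falls below
      \<open>2 / N <= d\<close>, while \<open>norm q <= N\<close> puts the pair into the finite
      set.\<close>
    define N where "N = max 2 (2 / d)"
    obtain p q where pq: "p \<in> hurwitz_integers" "q \<in> hurwitz_integers" "1 \<le> norm q" "norm q \<le> N"
      "norm (\<xi> - p * inverse q) < 2 / (norm q * N)"
      using dirichlet_hurwitz_quotient[of N \<xi>] by (auto simp: N_def)
    have N: "N \<ge> 2" "N \<ge> 2 / d" by (simp_all add: N_def)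
    have "2 / (norm q * N) \<le> 2 / (norm q * norm q)"
      using pq(3,4) N by (intro divide_left_mono mult_left_mono mult_pos_pos) auto
    then have "norm (\<xi> - p * inverse q) \<in> E"
      using pq unfolding E_def by (force simp: power2_eq_square)
    then have "d \<le> norm (\<xi> - p * inverse q)" by (rule d(2))
    also have "\<dots> < 2 / (norm q * N)" by (rule pq(5))
    also have "\<dots> \<le> 2 / (1 * N)"
      using pq(3) N by (intro divide_left_mono mult_right_mono mult_pos_pos) auto
    also have "\<dots> \<le> d" using N d(1) by (simp add: field_simps)
    finally show False by simp
  qed
qed

theorem theorem4p1:
  fixes \<xi> :: quat
  shows "(\<forall>N::int. N > 1 \<longrightarrow>
            (\<exists>p\<in>hurwitz_integers. \<exists>q\<in>hurwitz_integers.
               1 \<le> norm q \<and> norm q \<le> of_int N \<and>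
               norm (\<xi> - p * inverse q) < 2 / (norm q * of_int N))) \<and>
         infinite {(p, q). p \<in> hurwitz_integers \<and> q \<in> hurwitz_integers \<and> q \<noteq> 0 \<and>
                     norm (\<xi> - p * inverse q) < 2 / (norm q)\<^sup>2}"
proof (intro conjI allI impI infinite_good_pairs)
  fix N :: int
  assume "N > 1"
  then have "real_of_int N \<ge> 2" by simp
  then show "\<exists>p\<in>hurwitz_integers. \<exists>q\<in>hurwitz_integers.
      1 \<le> norm q \<and> norm q \<le> of_int N \<and> norm (\<xi> - p * inverse q) < 2 / (norm q * of_int N)"
    using dirichlet_hurwitz_quotient by metis
qed

end
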